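(* Let $M\in\mathbb{R}^{m\times m}$ be symmetric positive definite, let $U^{j}:\mathbb{R}^j\to\mathbb{R}^m_M$ be an exact data matrix, let $\vec u^{j+1}\in\mathbb{R}^m_M$ be a new data column, and let $U^{j+1}=\begin{bmatrix}U^{j}&\vec u^{j+1}\end{bmatrix}:\mathbb{R}^{j+1}\to\mathbb{R}^m_M$. Let $\widetilde U^{j}$ and $\widetilde U^{j+1}$ be the iPOD approximations of $U^{j}$ and $U^{j+1}$, respectively, where $\widetilde U^{j+1}$ is obtained from $\widetilde U^{j}$ and $\vec u^{j+1}$ by one iPOD step, and let $\widetilde U^{j}=V^j\Sigma^j(W^j)^T$ be the core $M$-weighted SVD. Suppose $$\|U^{j}-\widetilde U^{j}\|_{\mathrm{HS}}\le \epsilon^{j},\qquad p^{j+1}=\|\vec u^{j+1}-V^jV^{j*}\vec u^{j+1}\|_{\mathbb{R}^m_M}.$$ Then $\|U^{j+1}-\widetilde U^{j+1}\|_{\mathrm{HS}}\le \epsilon^{j+1}$, where $$\epsilon^{j+1}=\begin{cases}\epsilon^{j} & \text{if no truncation is applied},\\ \epsilon^{j}+p^{j+1} & \text{if } p\text{-truncation is applied},\\ \epsilon^{j}+\sigma_l^{j+1} & \text{if SV-truncation is applied},\end{cases}$$ and $\sigma_1^{j+1}\ge\dots\ge\sigma_l^{j+1}>0$ are the (positive) singular values of the matrix $\begin{bmatrix}\widetilde U^{j}&\vec u^{j+1}\end{bmatrix}:\mathbb{R}^{j+1}\to\mathbb{R}^m_M$.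
   Context: $\mathbb{R}^m_M$ is $\mathbb{R}^m$ with inner product $(\vec x,\vec y)_{\mathbb{R}^m_M}=\vec y^TM\vec x$. For a matrix $U=\begin{bmatrix}\vec u^1&\cdots&\vec u^n\end{bmatrix}$ regarded as an operator $\mathbb{R}^n\to\mathbb{R}^m_M$, $\|U\|_{\mathrm{HS}}$ is its Hilbert-Schmidt norm with respect to the standard inner product on $\mathbb{R}^n$ and the $M$-inner product on $\mathbb{R}^m$. The core $M$-weighted SVD of such a $U$ is a decomposition $U=V\Sigma W^T$ with $V\in\mathbb{R}^{m\times s}$, $\Sigma=\mathrm{diag}(\sigma_1,\dots,\sigma_s)$, $W\in\mathbb{R}^{n\times s}$, $V^TMV=I$, $W^TW=I$ and $\sigma_1\ge\dots\ge\sigma_s>0$ (only the positive singular values are kept). For $V$ in such a decomposition, $V^*=V^TM$. One step of the incremental proper orthogonal decomposition (iPOD), with user-chosen thresholds $\mathtt{tol}_p,\mathtt{tol}_{sv}>0$: given the current approximation $\widetilde U^j=V^j\Sigma^j(W^j)^T$ (core $M$-weighted SVD) and a new column $\vec u^{j+1}$, put $p^{j+1}=\|\vec u^{j+1}-V^jV^{j*}\vec u^{j+1}\|_{\mathbb{R}^m_M}$. (i) $p$-truncation: if $p^{j+1}<\mathtt{tol}_p$, then $\widetilde U^{j+1}=\begin{bmatrix}\widetilde U^j& V^jV^{j*}\vec u^{j+1}\end{bmatrix}$. (ii) SV-truncation: if $p^{j+1}\ge\mathtt{tol}_p$ and the smallest positive singular value $\sigma_l^{j+1}$ of $\begin{bmatrix}\widetilde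 U^j&\vec u^{j+1}\end{bmatrix}:\mathbb{R}^{j+1}\to\mathbb{R}^m_M$ is less than $\mathtt{tol}_{sv}$, then $\widetilde U^{j+1}$ is obtained from the core $M$-weighted SVD of $\begin{bmatrix}\widetilde U^j&\vec u^{j+1}\end{bmatrix}$ by deleting that one singular value $\sigma_l^{j+1}$ and its left and right singular vectors. (iii) No truncation: otherwise, $\widetilde U^{j+1}=\begin{bmatrix}\widetilde U^j&\vec u^{j+1}\end{bmatrix}$. The iPOD starts from $\widetilde U^1=\vec u^1\neq0$. *)

theory Defs
  imports "Jordan_Normal_Form.Char_Poly" Complex_Main
begin

definition sym_pos_def :: "nat \<Rightarrow> real mat \<Rightarrow> bool" where
  "sym_pos_def m M \<longleftrightarrow> M \<in> carrier_mat m m \<and> transpose_mat M = M \<and>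
     (\<forall>x \<in> carrier_vec m. x \<noteq> 0\<^sub>v m \<longrightarrow> x \<bullet> (M *\<^sub>v x) > 0)"

definition M_inner :: "real mat \<Rightarrow> real vec \<Rightarrow> real vec \<Rightarrow> real" where
  "M_inner M x y = y \<bullet> (M *\<^sub>v x)"

definition M_norm :: "real mat \<Rightarrow> real vec \<Rightarrow> real" where
  "M_norm M x = sqrt (M_inner M x x)"

(* Hilbert adjoint of A : R^n -> R^m, where R^n carries the standard inner product
   and R^m the M-inner product (M symmetric). *)
definition M_adjoint :: "real mat \<Rightarrow> real mat \<Rightarrow> real mat" where
  "M_adjoint M A = transpose_mat A * M"

definition hs_norm :: "real mat \<Rightarrow> real mat \<Rightarrow> real" where
  "hs_norm M A = sqrt (\<Sum>k<dim_col A. (M_norm M (A *\<^sub>v unit_vec (dim_col A) k))\<^sup>2)"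

definition pos_singular_values :: "real mat \<Rightarrow> real mat \<Rightarrow> real set" where
  "pos_singular_values M A = {sqrt l |l. eigenvalue (M_adjoint M A * A) l \<and> l > 0}"

(* Multiplicities do not matter here.  Meaningful only for A \<noteq> 0, since Min {} is unspecified. *)
definition min_pos_singular_value :: "real mat \<Rightarrow> real mat \<Rightarrow> real" where
  "min_pos_singular_value M A = Min (pos_singular_values M A)"

definition core_svd :: "real mat \<Rightarrow> real mat \<Rightarrow> real mat \<Rightarrow> real list \<Rightarrow> real mat \<Rightarrow> bool" where
  "core_svd M A V \<sigma> W \<longleftrightarrow>
     V \<in> carrier_mat (dim_row A) (length \<sigma>) \<and>
     W \<in> carrier_mat (dim_col A) (length \<sigma>) \<and>
     A = V * mat_diag (length \<sigma>) (\<lambda>i. \<sigma> ! i) * transpose_mat W \<and>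
     transpose_mat V * M * V = 1\<^sub>m (length \<sigma>) \<and>
     transpose_mat W * W = 1\<^sub>m (length \<sigma>) \<and>
     sorted_wrt (\<ge>) \<sigma> \<and> (\<forall>s \<in> set \<sigma>. s > 0)"

definition append_col :: "real mat \<Rightarrow> real vec \<Rightarrow> real mat" where
  "append_col A u = mat_of_cols (dim_row A) (cols A @ [u])"

definition delete_last_col :: "real mat \<Rightarrow> real mat" where
  "delete_last_col A = mat_of_cols (dim_row A) (butlast (cols A))"

definition proj :: "real mat \<Rightarrow> real mat \<Rightarrow> real vec \<Rightarrow> real vec" where
  "proj M V u = (V * M_adjoint M V) *\<^sub>v u"

definition residual :: "real mat \<Rightarrow> real mat \<Rightarrow> real vec \<Rightarrow> real" where
  "residual M V u = M_norm M (u - proj M V u)"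

datatype truncation = No_Truncation | P_Truncation | SV_Truncation

(* The step is a relation: the core SVD is unique only up to the choice of singular vectors,
   so the result of an SV-truncation need not be unique.  V is the left factor of a core SVD
   of A; the truncation argument records which of the three cases applies. *)
inductive ipod_step ::
  "real mat \<Rightarrow> real \<Rightarrow> real \<Rightarrow> real mat \<Rightarrow> real mat \<Rightarrow> real vec \<Rightarrow> truncation \<Rightarrow> real mat \<Rightarrow> bool"
  for M :: "real mat" and tol_p tol_sv :: real and V A :: "real mat" and u :: "real vec"
where
  p_trunc:
    "residual M V u < tol_p \<Longrightarrow>
     ipod_step M tol_p tol_sv V A u P_Truncation (append_col A (proj M V u))"
| sv_trunc:
    "residual M V u \<ge> tol_p \<Longrightarrow>
     min_pos_singular_value M (append_col A u) < tol_sv \<Longrightarrow>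
     core_svd M (append_col A u) Q \<sigma> R \<Longrightarrow>
     ipod_step M tol_p tol_sv V A u SV_Truncation
       (delete_last_col Q * mat_diag (length \<sigma> - 1) (\<lambda>i. \<sigma> ! i)
         * transpose_mat (delete_last_col R))"
| no_trunc:
    "residual M V u \<ge> tol_p \<Longrightarrow>
     min_pos_singular_value M (append_col A u) \<ge> tol_sv \<Longrightarrow>
     ipod_step M tol_p tol_sv V A u No_Truncation (append_col A u)"

(* ipod M tol_p tol_sv U A: A is an iPOD approximation of the exact data matrix U,
   obtained by processing the columns of U from left to right. *)
inductive ipod :: "real mat \<Rightarrow> real \<Rightarrow> real \<Rightarrow> real mat \<Rightarrow> real mat \<Rightarrow> bool"
  for M :: "real mat" and tol_p tol_sv :: real
where
  start:
    "u \<in> carrier_vec (dim_row M) \<Longrightarrow> u \<noteq> 0\<^sub>v (dim_row M) \<Longrightarrow>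
     ipod M tol_p tol_sv (mat_of_cols (dim_row M) [u]) (mat_of_cols (dim_row M) [u])"
| step:
    "ipod M tol_p tol_sv U A \<Longrightarrow> core_svd M A V \<sigma> W \<Longrightarrow> u \<in> carrier_vec (dim_row M) \<Longrightarrow>
     ipod_step M tol_p tol_sv V A u k A' \<Longrightarrow>
     ipod M tol_p tol_sv (append_col U u) A'"

end

theory Submission
  imports Defs "HOL-Analysis.L2_Norm"
begin

text \<open>
  The Hilbert-Schmidt norm with respect to \<open>M\<close> is the Euclidean combination of the \<open>M\<close>-norms of
  the columns, so appending a column to both the data and the approximation adds the square of
  the new column's error to the square of the old error
  (\<open>append_col_diff\<close>, \<open>hs_norm_append_col\<close>). If the new column is stored exactly, it contributes
  nothing. If it is replaced by its projection, it contributes the square of the residual \<open>p\<close>, and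
  \<open>sqrt (a\<^sup>2 + p\<^sup>2) \<le> a + p\<close>.

  An SV-truncation changes all columns, so there the triangle inequality (\<open>hs_norm_triangle\<close>) is
  applied with the untruncated matrix \<open>append_col Ut u\<close> in between. The first distance is the old
  error, as before. The second is the Hilbert-Schmidt norm of the deleted rank-one summand
  \<open>\<sigma>\<^sub>l q\<^sub>l r\<^sub>l\<^sup>T\<close>, which is \<open>\<sigma>\<^sub>l\<close> because \<open>q\<^sub>l\<close> and \<open>r\<^sub>l\<close> are unit vectors for the \<open>M\<close>-norm
  and the standard norm
  (\<open>hs_norm_delete_last_singular_triple\<close>).

  Two facts connect this to the definitions. The smallest positive singular value is defined
  through the eigenvalues of the Gram matrix rather than through a chosen decomposition; the
  diagonalization of the Gram matrix by \<open>W\<close> identifies its positive eigenvalues with the squares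
  of the \<open>\<sigma>\<^sub>i\<close> (\<open>pos_singular_values_core_svd\<close>). And a deleted triple must exist: the residual is at least the positive tolerance, hence \<open>u\<close> is nonzero, and a nonzero
  matrix has a nonempty core SVD (\<open>core_svd_append_col_nonempty\<close>).
\<close>

section \<open>The weighted norm on vectors\<close>

lemma M_inner_add_left:
  assumes "M \<in> carrier_mat m m" "x \<in> carrier_vec m" "y \<in> carrier_vec m" "z \<in> carrier_vec m"
  shows "M_inner M (x + y) z = M_inner M x z + M_inner M y z"
  using assms unfolding M_inner_def
  by (simp add: mult_add_distrib_mat_vec[of _ m m] scalar_prod_add_distrib[of _ m])

lemma M_inner_smult_left:
  assumes "M \<in> carrier_mat m m" "x \<in> carrier_vec m" "z \<in> carrier_vec m"
  shows "M_inner M (c \<cdot>\<^sub>v x) z = c * M_inner M x z"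
  using assms unfolding M_inner_def by (simp add: mult_mat_vec[of _ m m])

lemma M_inner_commute:
  assumes "sym_pos_def m M" "x \<in> carrier_vec m" "y \<in> carrier_vec m"
  shows "M_inner M x y = M_inner M y x"
proof -
  from assms have M: "M \<in> carrier_mat m m" "transpose_mat M = M"
    by (auto simp: sym_pos_def_def)
  have "y \<bullet> (M *\<^sub>v x) = (M *\<^sub>v y) \<bullet> x"
    using transpose_vec_mult_scalar[OF M(1) assms(2,3)] M(2) by simp
  also have "\<dots> = x \<bullet> (M *\<^sub>v y)"
    using M assms by (intro comm_scalar_prod[of _ m]) auto
  finally show ?thesis by (simp add: M_inner_def)
qed

lemma M_inner_nonneg:
  assumes "sym_pos_def m M" "x \<in> carrier_vec m"
  shows "M_inner M x x \<ge> 0"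
proof (cases "x = 0\<^sub>v m")
  case True
  then show ?thesis using assms by (auto simp: M_inner_def sym_pos_def_def)
next
  case False
  then show ?thesis using assms by (auto simp: M_inner_def sym_pos_def_def less_imp_le)
qed

lemma M_norm_zero: "M \<in> carrier_mat m m \<Longrightarrow> M_norm M (0\<^sub>v m) = 0"
  by (simp add: M_norm_def M_inner_def)

lemma M_norm_smult:
  assumes "M \<in> carrier_mat m m" "x \<in> carrier_vec m"
  shows "M_norm M (c \<cdot>\<^sub>v x) = \<bar>c\<bar> * M_norm M x"
proof -
  have "M_inner M (c \<cdot>\<^sub>v x) (c \<cdot>\<^sub>v x) = c\<^sup>2 * M_inner M x x"
    using assms unfolding M_inner_def
    by (simp add: mult_mat_vec[of _ m m] power2_eq_square)
  then show ?thesis by (simp add: M_norm_def real_sqrt_mult)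
qed

lemma M_inner_add_self:
  assumes "sym_pos_def m M" "x \<in> carrier_vec m" "y \<in> carrier_vec m"
  shows "M_inner M (x + y) (x + y) = M_inner M x x + 2 * M_inner M x y + M_inner M y y"
proof -
  have M: "M \<in> carrier_mat m m" using assms(1) by (simp add: sym_pos_def_def)
  have "M_inner M (x + y) (x + y) = M_inner M x (x + y) + M_inner M y (x + y)"
    using M assms by (simp add: M_inner_add_left[of M m])
  also have "\<dots> = M_inner M (x + y) x + M_inner M (x + y) y"
    using assms by (simp add: M_inner_commute[of m M])
  also have "\<dots> = M_inner M x x + M_inner M y x + (M_inner M x y + M_inner M y y)"
    using M assms by (simp add: M_inner_add_left[of M m])
  finally show ?thesis using M_inner_commute[OF assms] by simp
qed

lemma M_inner_Cauchy_Schwarz: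
  assumes spd: "sym_pos_def m M" and x: "x \<in> carrier_vec m" and y: "y \<in> carrier_vec m"
  shows "M_inner M x y \<le> M_norm M x * M_norm M y"
proof (cases "y = 0\<^sub>v m")
  case True
  then show ?thesis using spd x M_inner_commute[OF spd x y] 
    by (auto simp: M_inner_def M_norm_def sym_pos_def_def)
next
  case False
  have M: "M \<in> carrier_mat m m" using spd by (simp add: sym_pos_def_def)
  define a b c where "a = M_inner M x x" and "b = M_inner M x y" and "c = M_inner M y y"
  have c: "c > 0" using spd y False by (auto simp: c_def M_inner_def sym_pos_def_def)
  (* the minimizer of t \<mapsto> a + 2 t b + t\<^sup>2 c, whose minimum a - b\<^sup>2 / c is nonnegative *)
  define t where "t = - b / c"
  have "0 \<le> M_inner M (x + t \<cdot>\<^sub>v y) (x + t \<cdot>\<^sub>v y)"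
    using x y by (intro M_inner_nonneg[OF spd]) auto
  also have "\<dots> = a + 2 * M_inner M (t \<cdot>\<^sub>v y) x + M_inner M (t \<cdot>\<^sub>v y) (t \<cdot>\<^sub>v y)"
    using M_inner_add_self[OF spd x, of "t \<cdot>\<^sub>v y"] M_inner_commute[OF spd x, of "t \<cdot>\<^sub>v y"] x y
    by (simp add: a_def)
  also have "M_inner M (t \<cdot>\<^sub>v y) x = t * b"
    using M_inner_smult_left[OF M y x] M_inner_commute[OF spd x y] by (simp add: b_def)
  also have "M_inner M (t \<cdot>\<^sub>v y) (t \<cdot>\<^sub>v y) = t * (t * c)"
    using M_inner_smult_left[OF M y, of "t \<cdot>\<^sub>v y"] M_inner_smult_left[OF M y y]
      M_inner_commute[OF spd y, of "t \<cdot>\<^sub>v y"] y by (simp add: c_def)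
  finally have "b\<^sup>2 \<le> a * c"
    using c by (simp add: t_def field_simps power2_eq_square)
  then have "\<bar>b\<bar> \<le> sqrt (a * c)"
    by (metis real_sqrt_abs real_sqrt_le_iff)
  then show ?thesis by (simp add: M_norm_def a_def b_def c_def real_sqrt_mult)
qed

lemma M_norm_triangle:
  assumes spd: "sym_pos_def m M" and x: "x \<in> carrier_vec m" and y: "y \<in> carrier_vec m"
  shows "M_norm M (x + y) \<le> M_norm M x + M_norm M y"
proof -
  have sq: "(M_norm M z)\<^sup>2 = M_inner M z z" and nonneg: "M_norm M z \<ge> 0"
    if "z \<in> carrier_vec m" for z
    using M_inner_nonneg[OF spd that] by (simp_all add: M_norm_def)
  have "(M_norm M (x + y))\<^sup>2 \<le> (M_norm M x + M_norm M y)\<^sup>2"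
    using M_inner_add_self[OF spd x y] M_inner_Cauchy_Schwarz[OF spd x y] sq x y
    by (simp add: power2_sum)
  then show ?thesis using nonneg x y by (auto intro: power2_le_imp_le)
qed

section \<open>The Hilbert-Schmidt norm\<close>

lemma hs_norm_eq_L2_set: "hs_norm M A = L2_set (\<lambda>k. M_norm M (col A k)) {..<dim_col A}"
proof -
  have "A *\<^sub>v unit_vec (dim_col A) k = col A k" if "k < dim_col A" for k
    using that by (intro eq_vecI) auto
  then show ?thesis by (simp add: hs_norm_def L2_set_def)
qed

text \<open>Minkowski's inequality is applied to the column norms, after the triangle inequality
  for \<open>M_norm\<close> in each column.\<close>

lemma hs_norm_triangle:
  assumes spd: "sym_pos_def m M" and A: "A \<in> carrier_mat m n" and B: "B \<in> carrier_mat m n"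
  shows "hs_norm M (A + B) \<le> hs_norm M A + hs_norm M B"
proof -
  have nonneg: "M_norm M x \<ge> 0" if "x \<in> carrier_vec m" for x
    using M_inner_nonneg[OF spd that] by (simp add: M_norm_def)
  have "hs_norm M (A + B) = L2_set (\<lambda>k. M_norm M (col A k + col B k)) {..<n}"
    using A B by (auto simp: hs_norm_eq_L2_set intro!: L2_set_cong)
  also have "\<dots> \<le> L2_set (\<lambda>k. M_norm M (col A k) + M_norm M (col B k)) {..<n}"
    using A B by (intro L2_set_mono M_norm_triangle[OF spd] nonneg) auto
  also have "\<dots> \<le> hs_norm M A + hs_norm M B"
    using L2_set_triangle_ineq[of "\<lambda>k. M_norm M (col A k)" "\<lambda>k. M_norm M (col B k)"] A B
    by (auto simp: hs_norm_eq_L2_set)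
  finally show ?thesis .
qed

lemma append_col_carrier [simp]:
  "A \<in> carrier_mat m n \<Longrightarrow> append_col A u \<in> carrier_mat m (Suc n)"
  unfolding append_col_def by (metis carrier_matD cols_length length_append_singleton mat_of_cols_carrier(1))

lemma append_col_dim [simp]:
  "dim_row (append_col A u) = dim_row A" "dim_col (append_col A u) = Suc (dim_col A)"
  by (simp_all add: append_col_def)

lemma col_append_col:
  assumes "A \<in> carrier_mat m n" "u \<in> carrier_vec m" "k < Suc n"
  shows "col (append_col A u) k = (if k < n then col A k else u)"
  using assms
  by (intro eq_vecI) (auto simp: append_col_def nth_append mat_of_cols_index less_Suc_eq)

lemma append_col_diff:
  assumes "A \<in> carrier_mat m n" "B \<in> carrier_mat m n" "u \<in> carrier_vec m" "v \<in> carrier_vec m"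
  shows "append_col A u - append_col B v = append_col (A - B) (u - v)"
  using assms
  by (intro eq_matI) (auto simp: append_col_def nth_append mat_of_cols_index less_Suc_eq)

lemma hs_norm_append_col:
  assumes A: "A \<in> carrier_mat m n" and u: "u \<in> carrier_vec m"
  shows "hs_norm M (append_col A u) = sqrt ((hs_norm M A)\<^sup>2 + (M_norm M u)\<^sup>2)"
proof -
  have "(\<Sum>k<Suc n. (M_norm M (col (append_col A u) k))\<^sup>2)
      = (\<Sum>k<n. (M_norm M (col A k))\<^sup>2) + (M_norm M u)\<^sup>2"
    using col_append_col[OF A u] by (simp add: lessThan_Suc)
  then show ?thesis using A
    by (simp add: hs_norm_eq_L2_set L2_set_def sum_nonneg)
qed

section \<open>Core singular value decompositions\<close>

lemma mult_mat_zero_vec: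
  assumes "(A :: real mat) \<in> carrier_mat n s"
  shows "A *\<^sub>v 0\<^sub>v s = 0\<^sub>v n"
  using assms by (intro eq_vecI) auto

lemma mat_diag_mult_vec:
  assumes "w \<in> carrier_vec s"
  shows "mat_diag s f *\<^sub>v w = vec s (\<lambda>i. f i * w $ i)"
  using assms
  by (intro eq_vecI) (auto simp: mat_diag_def scalar_prod_def if_distrib if_distribR sum.delta cong: if_cong)

lemma transpose_mat_diag: "transpose_mat (mat_diag s f) = mat_diag s f"
  by (auto simp: mat_diag_def)

lemma mat_diag_mult_transpose_index:
  assumes "Q \<in> carrier_mat m s" "R \<in> carrier_mat n s" "i < m" "k < n"
  shows "(Q * mat_diag s f * transpose_mat R) $$ (i, k) = (\<Sum>a<s. Q $$ (i, a) * f a * R $$ (k, a))"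
  using assms
  by (auto simp: mat_diag_mult_right scalar_prod_def lessThan_atLeast0)

text \<open>The \<open>M\<close>-orthonormality of the left factor cancels it from the Gram matrix, which leaves a
  spectral decomposition on the column space of \<open>W\<close>.\<close>

lemma core_svd_gram:
  assumes M: "M \<in> carrier_mat m m" and A: "A \<in> carrier_mat m n" and svd: "core_svd M A V \<sigma> W"
  shows "M_adjoint M A * A
    = W * mat_diag (length \<sigma>) (\<lambda>i. (\<sigma> ! i)\<^sup>2) * transpose_mat W"
proof -
  define s D where "s = length \<sigma>" and "D = mat_diag s (\<lambda>i. \<sigma> ! i)"
  have V: "V \<in> carrier_mat m s" and W: "W \<in> carrier_mat n s" and D: "D \<in> carrier_mat s s"
    and A_eq: "A = V * D * transpose_mat W" and orth: "transpose_mat V * M * V = 1\<^sub>m s"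
    using svd A by (auto simp: core_svd_def s_def D_def)
  have VT: "transpose_mat V \<in> carrier_mat s m" and WT: "transpose_mat W \<in> carrier_mat s n"
    using V W by auto
  have AT: "transpose_mat A = W * D * transpose_mat V"
  proof -
    have "transpose_mat A = W * transpose_mat (V * D)"
      unfolding A_eq using transpose_mult[of "V * D" m s "transpose_mat W" n] V D WT by auto
    also have "transpose_mat (V * D) = D * transpose_mat V"
      using transpose_mult[OF V D] by (simp add: D_def transpose_mat_diag)
    finally have "transpose_mat A = W * (D * transpose_mat V)" .
    then show ?thesis using W D VT by (simp add: assoc_mult_mat[of _ n s _ s _ m])
  qed
  have WD: "W * D \<in> carrier_mat n s" and DW: "D * transpose_mat W \<in> carrier_mat s n"
    using W D WT by auto
  have "M_adjoint M A * A = W * D * transpose_mat V * M * (V * (D * transpose_mat W))"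
    unfolding M_adjoint_def AT using A_eq V D WT by (simp add: assoc_mult_mat[of _ m s _ s _ n])
  also have "\<dots> = W * D * (transpose_mat V * M) * (V * (D * transpose_mat W))"
    using WD VT M by (simp add: assoc_mult_mat[of _ n s _ m _ m])
  also have "\<dots> = W * D * (transpose_mat V * M * (V * (D * transpose_mat W)))"
    using WD VT M V DW by (intro assoc_mult_mat[of _ n s _ m _ n]) auto
  also have "transpose_mat V * M * (V * (D * transpose_mat W))
      = transpose_mat V * M * V * (D * transpose_mat W)"
    using VT M V DW by (intro assoc_mult_mat[symmetric, of _ s m _ s _ n]) auto
  also have "\<dots> = D * transpose_mat W"
    unfolding orth by (rule left_mult_one_mat[OF DW])
  also have "W * D * (D * transpose_mat W) = W * (D * D) * transpose_mat W"
    using W D WT WD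
    by (simp add: assoc_mult_mat[of _ n s _ s _ n, symmetric] assoc_mult_mat[of _ n s _ s _ s])
  also have "D * D = mat_diag s (\<lambda>i. (\<sigma> ! i)\<^sup>2)"
    by (simp add: D_def power2_eq_square)
  finally show ?thesis by (simp add: s_def)
qed

text \<open>The columns of \<open>W\<close> are eigenvectors of the Gram matrix for the \<open>\<sigma>\<^sub>i\<^sup>2\<close>. Conversely, an
  eigenvector \<open>v\<close> with nonzero eigenvalue lies in the range of \<open>W\<close>, so its coordinate vector
  \<open>W\<^sup>T v\<close> is a nonzero eigenvector of the diagonal factor.\<close>

lemma pos_singular_values_core_svd:
  assumes M: "M \<in> carrier_mat m m" and A: "A \<in> carrier_mat m n" and svd: "core_svd M A V \<sigma> W"
  shows "pos_singular_values M A = set \<sigma>"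
proof -
  define s G where "s = length \<sigma>" and "G = M_adjoint M A * A"
  define E where "E = mat_diag s (\<lambda>i. (\<sigma> ! i)\<^sup>2)"
  have W: "W \<in> carrier_mat n s" and orth: "transpose_mat W * W = 1\<^sub>m s"
    and pos: "\<And>x. x \<in> set \<sigma> \<Longrightarrow> x > 0"
    using svd A by (auto simp: core_svd_def s_def)
  have WT: "transpose_mat W \<in> carrier_mat s n" and E: "E \<in> carrier_mat s s"
    using W by (auto simp: E_def)
  have G_eq: "G = W * E * transpose_mat W"
    using core_svd_gram[OF M A svd] by (simp add: G_def E_def s_def)
  have G: "G \<in> carrier_mat n n" using W E WT unfolding G_eq by auto
  have G_vec: "G *\<^sub>v v = W *\<^sub>v (E *\<^sub>v (transpose_mat W *\<^sub>v v))" if "v \<in> carrier_vec n" for v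
    unfolding G_eq using W E WT that 
    by (simp add: assoc_mult_mat_vec[of _ n s _ n] assoc_mult_mat_vec[of _ n s _ s])
  have WTW: "transpose_mat W *\<^sub>v (W *\<^sub>v w) = w" if "w \<in> carrier_vec s" for w
    using assoc_mult_mat_vec[OF WT W that] orth that by simp
  have "eigenvalue G ((\<sigma> ! i)\<^sup>2)" if i: "i < s" for i
  proof -
    define e where "e = (unit_vec s i :: real vec)"
    have e: "e \<in> carrier_vec s" by (simp add: e_def)
    have Ee: "E *\<^sub>v e = (\<sigma> ! i)\<^sup>2 \<cdot>\<^sub>v e"
      unfolding E_def mat_diag_mult_vec[OF e] using i by (intro eq_vecI) (auto simp: e_def)
    have We: "W *\<^sub>v e \<in> carrier_vec n" using W e by auto
    have "G *\<^sub>v (W *\<^sub>v e) = (\<sigma> ! i)\<^sup>2 \<cdot>\<^sub>v (W *\<^sub>v e)"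
      using G_vec[OF We] WTW[OF e] Ee mult_mat_vec[OF W e] by simp
    moreover have "W *\<^sub>v e \<noteq> 0\<^sub>v n"
    proof
      assume "W *\<^sub>v e = 0\<^sub>v n"
      then have "e = 0\<^sub>v s" using WTW[OF e] mult_mat_zero_vec[OF WT] by simp
      then have "e $ i = 0" using i by simp
      then show False using i by (simp add: e_def)
    qed
    ultimately show ?thesis
      using We G unfolding eigenvalue_def eigenvector_def by auto
  qed
  moreover have "\<exists>i<s. l = (\<sigma> ! i)\<^sup>2" if ev: "eigenvalue G l" and l: "l > 0" for l
  proof -
    obtain v where v: "v \<in> carrier_vec n" "v \<noteq> 0\<^sub>v n" "G *\<^sub>v v = l \<cdot>\<^sub>v v"
      using ev G by (auto simp: eigenvalue_def eigenvector_def)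
    define w where "w = transpose_mat W *\<^sub>v v"
    have w: "w \<in> carrier_vec s" using WT v by (simp add: w_def)
    have eq: "W *\<^sub>v (E *\<^sub>v w) = l \<cdot>\<^sub>v v" using G_vec[OF v(1)] v(3) by (simp add: w_def)
    have Ew: "E *\<^sub>v w = l \<cdot>\<^sub>v w"
      using arg_cong[OF eq, of "\<lambda>x. transpose_mat W *\<^sub>v x"] WTW[of "E *\<^sub>v w"] E w
        mult_mat_vec[OF WT v(1)] by (simp add: w_def)
    have "w \<noteq> 0\<^sub>v s"
    proof
      assume "w = 0\<^sub>v s"
      then have "l \<cdot>\<^sub>v v = 0\<^sub>v n" using eq mult_mat_zero_vec[OF E] mult_mat_zero_vec[OF W] by simp
      then have "l * v $ i = 0" if "i < n" for i
        using that v(1) by (metis carrier_vecD index_smult_vec(1) index_zero_vec(1))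
      then have "v = 0\<^sub>v n" using v(1) l by (intro eq_vecI) auto
      then show False using v(2) by simp
    qed
    then obtain i where i: "i < s" "w $ i \<noteq> 0"
      using w by (metis carrier_vecD eq_vecI index_zero_vec)
    have "(\<sigma> ! i)\<^sup>2 * w $ i = l * w $ i"
      using arg_cong[OF Ew, of "\<lambda>x. x $ i"] i w unfolding E_def mat_diag_mult_vec[OF w] by simp
    then show ?thesis using i by auto
  qed
  ultimately have spec: "{l. eigenvalue G l \<and> l > 0} = (\<lambda>x. x\<^sup>2) ` set \<sigma>"
    using pos by (fastforce simp: s_def in_set_conv_nth)
  have "pos_singular_values M A = sqrt ` {l. eigenvalue G l \<and> l > 0}"
    by (auto simp: pos_singular_values_def G_def)
  also have "\<dots> = set \<sigma>"
    unfolding spec image_image using pos by (simp add: less_imp_le)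
  finally show ?thesis .
qed

lemma min_pos_singular_value_core_svd:
  assumes M: "M \<in> carrier_mat m m" and A: "A \<in> carrier_mat m n" and svd: "core_svd M A V \<sigma> W"
    and ne: "\<sigma> \<noteq> []"
  shows "min_pos_singular_value M A = last \<sigma>"
  unfolding min_pos_singular_value_def pos_singular_values_core_svd[OF M A svd]
proof (rule Min_eqI)
  fix x assume "x \<in> set \<sigma>"
  then obtain i where i: "i < length \<sigma>" "x = \<sigma> ! i" by (auto simp: in_set_conv_nth)
  have "sorted_wrt (\<ge>) \<sigma>" using svd by (simp add: core_svd_def)
  then show "last \<sigma> \<le> x"
    using i ne sorted_wrt_nth_less[of "(\<ge>)" \<sigma> i "length \<sigma> - 1"]
    by (cases "i = length \<sigma> - 1") (auto simp: last_conv_nth)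
qed (use ne in auto)

text \<open>Column \<open>k\<close> of the deleted summand is the last left singular vector scaled by
  \<open>\<sigma>\<^sub>l R\<^sub>k\<^sub>l\<close>. Its \<open>M\<close>-norm is the modulus of that factor, and the squares of the \<open>R\<^sub>k\<^sub>l\<close> sum to one.\<close>

lemma hs_norm_delete_last_singular_triple:
  assumes spd: "sym_pos_def m M" and A: "A \<in> carrier_mat m n" and svd: "core_svd M A Q \<sigma> R"
    and ne: "\<sigma> \<noteq> []"
  shows "hs_norm M (A - delete_last_col Q * mat_diag (length \<sigma> - 1) (\<lambda>i. \<sigma> ! i)
           * transpose_mat (delete_last_col R)) = last \<sigma>" (is "hs_norm M (A - ?T) = _")
proof -
  have M: "M \<in> carrier_mat m m" using spd by (simp add: sym_pos_def_def)
  obtain l where l: "length \<sigma> = Suc l" using ne by (cases \<sigma>) auto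
  have last: "last \<sigma> = \<sigma> ! l" using l ne by (simp add: last_conv_nth)
  have Q: "Q \<in> carrier_mat m (Suc l)" and R: "R \<in> carrier_mat n (Suc l)"
    and A_eq: "A = Q * mat_diag (Suc l) (\<lambda>i. \<sigma> ! i) * transpose_mat R"
    and QQ: "transpose_mat Q * M * Q = 1\<^sub>m (Suc l)" and RR: "transpose_mat R * R = 1\<^sub>m (Suc l)"
    and pos: "\<sigma> ! l > 0"
    using svd A l by (auto simp: core_svd_def)
  have del: "delete_last_col X \<in> carrier_mat r l"
    "\<And>i a. i < r \<Longrightarrow> a < l \<Longrightarrow> delete_last_col X $$ (i, a) = X $$ (i, a)"
    if "X \<in> carrier_mat r (Suc l)" for X :: "real mat" and r
  proof -
    show "delete_last_col X \<in> carrier_mat r l"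
      using that mat_of_cols_carrier(1)[of r "butlast (cols X)"]
      by (simp add: delete_last_col_def)
    show "delete_last_col X $$ (i, a) = X $$ (i, a)" if "i < r" "a < l" for i a
      using that \<open>X \<in> carrier_mat r (Suc l)\<close>
      by (simp add: delete_last_col_def mat_of_cols_index nth_butlast)
  qed
  have T: "?T \<in> carrier_mat m n" using del(1)[OF Q] del(1)[OF R] l by auto
  have col_eq: "col (A - ?T) k = (\<sigma> ! l * R $$ (k, l)) \<cdot>\<^sub>v col Q l" if k: "k < n" for k
  proof (intro eq_vecI)
    fix i assume "i < dim_vec ((\<sigma> ! l * R $$ (k, l)) \<cdot>\<^sub>v col Q l)"
    then have i: "i < m" using Q by simp
    have "A $$ (i, k) = (\<Sum>a<Suc l. Q $$ (i, a) * \<sigma> ! a * R $$ (k, a))"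
      unfolding A_eq using mat_diag_mult_transpose_index[OF Q R i k] .
    moreover have "?T $$ (i, k) = (\<Sum>a<l. Q $$ (i, a) * \<sigma> ! a * R $$ (k, a))"
      using mat_diag_mult_transpose_index[OF del(1)[OF Q] del(1)[OF R] i k] 
        del(2)[OF Q i] del(2)[OF R k] l by simp
    ultimately show "col (A - ?T) k $ i = ((\<sigma> ! l * R $$ (k, l)) \<cdot>\<^sub>v col Q l) $ i"
      using A T Q i k by (simp del: index_mult_mat)
  qed (use T Q in auto)
  have Ql: "col Q l \<in> carrier_vec m" using Q by auto
  have "M_inner M (col Q l) (col Q l) = (transpose_mat Q * (M * Q)) $$ (l, l)"
    using Q M by (simp add: M_inner_def mult_mat_vec_def)
  also have "\<dots> = 1" using QQ Q M by (simp add: assoc_mult_mat[of _ "Suc l" m _ m _ "Suc l"])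
  finally have unit_Q: "M_norm M (col Q l) = 1" by (simp add: M_norm_def)
  have "(\<Sum>k<n. (R $$ (k, l))\<^sup>2) = (transpose_mat R * R) $$ (l, l)"
    using R by (simp add: scalar_prod_def power2_eq_square lessThan_atLeast0)
  then have unit_R: "(\<Sum>k<n. (R $$ (k, l))\<^sup>2) = 1" using RR by simp
  have "hs_norm M (A - ?T) = sqrt (\<Sum>k<n. (\<sigma> ! l * R $$ (k, l))\<^sup>2)"
  proof -
    have "M_norm M (col (A - ?T) k) = \<bar>\<sigma> ! l * R $$ (k, l)\<bar>" if "k < n" for k
      unfolding col_eq[OF that] M_norm_smult[OF M Ql] unit_Q by simp
    moreover have "dim_col (A - ?T) = n" using carrier_matD(2)[OF T] by simp
    ultimately show ?thesis
      unfolding hs_norm_eq_L2_set L2_set_def by (intro arg_cong[of _ _ sqrt] sum.cong) auto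
  qed
  also have "\<dots> = \<sigma> ! l"
    using pos unit_R by (simp add: power_mult_distrib sum_distrib_left[symmetric])
  finally show ?thesis using last by simp
qed

section \<open>The iPOD step\<close>

lemma proj_carrier:
  assumes "V \<in> carrier_mat m s"
  shows "proj M V u \<in> carrier_vec m"
  using assms unfolding proj_def by (intro carrier_vecI) simp

lemma ipod_step_dim:
  assumes "ipod_step M tol_p tol_sv V A u k A'"
  shows "dim_row A' = dim_row A \<and> dim_col A' = Suc (dim_col A)"
  using assms
  by cases (auto simp: core_svd_def delete_last_col_def)

lemma ipod_dim:
  assumes "ipod M tol_p tol_sv U A"
  shows "dim_row A = dim_row U \<and> dim_col A = dim_col U"
  using assms
  by induction (auto dest: ipod_step_dim)

text \<open>Under a positive tolerance, a zero column is always handled by \<open>p\<close>-truncation; the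
  other cases may therefore rely on a nonzero column.\<close>

lemma residual_zero:
  assumes "M \<in> carrier_mat m m" "V \<in> carrier_mat m s"
  shows "residual M V (0\<^sub>v m) = 0"
proof -
  have "V * M_adjoint M V \<in> carrier_mat m m" using assms by (auto simp: M_adjoint_def)
  then have "proj M V (0\<^sub>v m) = 0\<^sub>v m" unfolding proj_def by (rule mult_mat_zero_vec)
  then show ?thesis using M_norm_zero[OF assms(1)] by (simp add: residual_def)
qed

text \<open>\<open>Min {}\<close> and the deletion from an empty decomposition are meaningless; this excludes
  both, since an empty decomposition factors only the zero matrix.\<close>

lemma core_svd_append_col_nonempty:
  assumes A: "A \<in> carrier_mat m n" and u: "u \<in> carrier_vec m" "u \<noteq> 0\<^sub>v m"
    and svd: "core_svd M (append_col A u) Q \<sigma> R"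
  shows "\<sigma> \<noteq> []"
proof
  assume "\<sigma> = []"
  then have Q: "Q \<in> carrier_mat m 0" and R: "R \<in> carrier_mat (Suc n) 0"
    and eq: "append_col A u = Q * mat_diag 0 (\<lambda>i. \<sigma> ! i) * transpose_mat R"
    using svd A by (auto simp: core_svd_def)
  have "u $ i = 0" if i: "i < m" for i
  proof -
    have "append_col A u $$ (i, n) = 0"
      unfolding eq using mat_diag_mult_transpose_index[OF Q R i, of n] by simp
    moreover have "col (append_col A u) n $ i = append_col A u $$ (i, n)"
      using A i by (intro index_col) auto
    ultimately show ?thesis using col_append_col[OF A u(1), of n] by simp
  qed
  then show False using u by (auto intro: eq_vecI)
qed

theorem theorem6:
  fixes M U Ut Ut' V W :: "real mat" and \<sigma> :: "real list" and u :: "real vec"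
    and m j :: nat and tol_p tol_sv \<epsilon> :: real and k :: truncation
  assumes "sym_pos_def m M"
    and "tol_p > 0" and "tol_sv > 0"
    and "U \<in> carrier_mat m j"
    and "u \<in> carrier_vec m"
    and "ipod M tol_p tol_sv U Ut"
    and "core_svd M Ut V \<sigma> W"
    and "ipod_step M tol_p tol_sv V Ut u k Ut'"
    and "hs_norm M (U - Ut) \<le> \<epsilon>"
  shows "hs_norm M (append_col U u - Ut') \<le>
    (case k of
       No_Truncation \<Rightarrow> \<epsilon>
     | P_Truncation \<Rightarrow> \<epsilon> + residual M V u
     | SV_Truncation \<Rightarrow> \<epsilon> + min_pos_singular_value M (append_col Ut u))"
proof -
  have M: "M \<in> carrier_mat m m" using assms(1) by (simp add: sym_pos_def_def)
  have U: "U \<in> carrier_mat m j" and u: "u \<in> carrier_vec m" by fact+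
  have Ut: "Ut \<in> carrier_mat m j" using ipod_dim[OF assms(6)] U by auto
  have V: "V \<in> carrier_mat m (length \<sigma>)" using assms(7) Ut by (auto simp: core_svd_def)
  have diff: "U - Ut \<in> carrier_mat m j" using U Ut by auto
  have hs_nonneg: "hs_norm M A \<ge> 0" for A by (simp add: hs_norm_eq_L2_set)
  have exact: "hs_norm M (append_col U u - append_col Ut u) = hs_norm M (U - Ut)"
  proof -
    have "u - u = 0\<^sub>v m" using u by auto
    then show ?thesis
      using hs_norm_append_col[OF diff zero_carrier_vec, of M] append_col_diff[OF U Ut u u]
        M_norm_zero[OF M] hs_nonneg by simp
  qed
  from assms(8) show ?thesis
  proof cases
    case p_trunc
    have P: "proj M V u \<in> carrier_vec m" using proj_carrier[OF V] .
    have rp: "residual M V u \<ge> 0"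
      using M_inner_nonneg[OF assms(1), of "u - proj M V u"] u P
      by (simp add: residual_def M_norm_def)
    have "hs_norm M (append_col U u - Ut') = sqrt ((hs_norm M (U - Ut))\<^sup>2 + (residual M V u)\<^sup>2)"
      using hs_norm_append_col[OF diff, of "u - proj M V u" M] append_col_diff[OF U Ut u P] u P p_trunc
      by (simp add: residual_def)
    also have "\<dots> \<le> hs_norm M (U - Ut) + residual M V u"
      using hs_nonneg rp by (rule sqrt_sum_squares_le_sum)
    finally show ?thesis using assms(9) p_trunc by simp
  next
    case (sv_trunc Q \<tau> R)
    have app: "append_col Ut u \<in> carrier_mat m (Suc j)" using Ut by simp
    have "u \<noteq> 0\<^sub>v m" using residual_zero[OF M V] sv_trunc assms(2) by auto
    then have ne: "\<tau> \<noteq> []" using core_svd_append_col_nonempty[OF Ut u] sv_trunc by blast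
    have Ut': "Ut' \<in> carrier_mat m (Suc j)" using ipod_step_dim[OF assms(8)] Ut by auto
    have split: "append_col U u - Ut'
        = (append_col U u - append_col Ut u) + (append_col Ut u - Ut')"
      using U Ut Ut' by (intro eq_matI) auto
    have "hs_norm M (append_col U u - Ut')
        \<le> hs_norm M (append_col U u - append_col Ut u) + hs_norm M (append_col Ut u - Ut')"
      unfolding split
      by (rule hs_norm_triangle[OF assms(1) minus_carrier_mat[OF app] minus_carrier_mat[OF Ut']])
    also have "hs_norm M (append_col Ut u - Ut') = last \<tau>"
      using hs_norm_delete_last_singular_triple[OF assms(1) app _ ne] sv_trunc by simp
    also have "\<dots> = min_pos_singular_value M (append_col Ut u)"
      using min_pos_singular_value_core_svd[OF M app _ ne] sv_trunc by simp
    finally show ?thesis using exact assms(9) sv_trunc by simp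
  next
    case no_trunc
    then show ?thesis using exact assms(9) by simp
  qed
qed

end
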